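(* Let $X$ be a random variable taking values in $[0,1]$ with mean $\mu=\mathbb{E}[X]>0$ and let $X_1,X_2,\dots$ be i.i.d. samples of $X$. Let $0<\delta<1$ and let $0<\varepsilon_a<\varepsilon_r<1$ be such that $p^\star+\varepsilon_a\le\frac12$, where $p^\star=\frac{\varepsilon_a}{\varepsilon_r}$. Let $\gamma>0$ and let $n$ be a positive integer with $$\gamma>\frac{1-\varepsilon_r}{\varepsilon_r},\quad \gamma>\frac{\ln\frac{\delta}{2}}{\mathscr{M}_{\mathrm{I}}\left(\frac{\gamma(p^\star-\varepsilon_a)}{\gamma-1+\varepsilon_r},p^\star\right)},\quad \gamma>\frac{\ln\frac{\delta}{2}}{\mathscr{M}_{\mathrm{I}}(p^\star+\varepsilon_a,p^\star)},\quad n>\frac{\ln\frac{\delta}{2}}{\mathscr{M}_{\mathrm{B}}(p^\star+\varepsilon_a,p^\star)}.$$ Let $\widehat{\mu}$ be the truncated inverse sampling estimator with threshold $\gamma$ and maximum sample size $n$. Then $$\Pr\left\{|\widehat{\mu}-\mu|<\varepsilon_a\ \text{ or }\ \left|\frac{\widehat{\mu}-\mu}{\mu}\right|<\varepsilon_r\right\}>1-\delta.$$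
   Context: Truncated inverse sampling with threshold $\gamma>0$ and maximum sample size $n$: the (random) number of samples is $\mathbf{n}=\min\{n,\ \min\{\ell\in\mathbb{N}:\sum_{i=1}^{\ell}X_i\ge\gamma\}\}$ (minimum of the empty set is $+\infty$), $\mathbf{k}=\sum_{i=1}^{\mathbf{n}}X_i$, and the estimator is $\widehat{\mu}=\min\{\mathbf{k},\gamma\}/\mathbf{n}$. For $0<z<1$ and $0<\mu<1$, $$\mathscr{M}_{\mathrm{B}}(z,\mu)=z\ln\left(\frac{\mu}{z}\right)+(1-z)\ln\left(\frac{1-\mu}{1-z}\right),\qquad \mathscr{M}_{\mathrm{I}}(z,\mu)=\frac1z\mathscr{M}_{\mathrm{B}}(z,\mu).$$ *)

theory Defs
  imports "HOL-Probability.Probability"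
begin

text \<open>The functions below act on one realisation \<open>x 1, x 2, \<dots>\<close> of the samples;
  \<open>x 0\<close> is not used.\<close>

text \<open>The minimum is formed in \<^typ>\<open>enat\<close>, where the infimum of the empty set is \<open>\<infinity>\<close>.
  It is at most \<open>n\<close>, hence finite, so \<^const>\<open>the_enat\<close> loses nothing.\<close>

definition sample_number :: "real \<Rightarrow> nat \<Rightarrow> (nat \<Rightarrow> real) \<Rightarrow> nat" where
  "sample_number \<gamma> n x =
     the_enat (min (enat n) (Inf {enat l |l. 1 \<le> l \<and> (\<Sum>i=1..l. x i) \<ge> \<gamma>}))"

definition sample_total :: "real \<Rightarrow> nat \<Rightarrow> (nat \<Rightarrow> real) \<Rightarrow> real" where
  "sample_total \<gamma> n x = (\<Sum>i=1..sample_number \<gamma> n x. x i)"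

definition tis_estimator :: "real \<Rightarrow> nat \<Rightarrow> (nat \<Rightarrow> real) \<Rightarrow> real" where
  "tis_estimator \<gamma> n x = min (sample_total \<gamma> n x) \<gamma> / real (sample_number \<gamma> n x)"

text \<open>These are meant for \<open>0 < z < 1\<close> and \<open>0 < \<mu> < 1\<close> only.\<close>

definition M_B :: "real \<Rightarrow> real \<Rightarrow> real" where
  "M_B z \<mu> = z * ln (\<mu> / z) + (1 - z) * ln ((1 - \<mu>) / (1 - z))"

definition M_I :: "real \<Rightarrow> real \<Rightarrow> real" where
  "M_I z \<mu> = 1 / z * M_B z \<mu>"

end

theory Submission
  imports Defs
begin

text \<open>
  The miss event is contained in \<open>{U \<le> estimator} \<union> {estimator \<le> L}\<close>, where \<open>U\<close> and \<open>L\<close> are \<open>\<mu>\<close> plus and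
  minus \<open>max \<epsilon>\<^sub>a (\<epsilon>\<^sub>r * \<mu>)\<close>. As the partial sums increase, each half is contained in a single tail event: of
  the sum of all \<open>n\<close> samples if the truncation is active, and otherwise of the partial sum at the
  deterministic time \<open>\<lfloor>\<gamma> / U\<rfloor>\<close> or \<open>\<lceil>\<gamma> / L\<rceil> - 1\<close>. These tails are bounded by Chernoff's method with an
  exponent that is optimal at \<open>\<mu> = p\<close> but used for every \<open>\<mu>\<close>: since \<open>ln (1 + \<mu> * c)\<close> is concave in \<open>\<mu>\<close>, its
  tangent at \<open>p\<close> (for \<open>\<mu> \<le> p\<close>) and its chord from \<open>0\<close> (for \<open>\<mu> > p\<close>) show that \<open>\<mu> = p\<close> is the worst case.
\<close>

subsection \<open>Chernoff exponents\<close>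

text \<open>Cumulant generating function of a Bernoulli variable with mean \<open>\<mu>\<close>; by convexity of \<open>exp\<close> it
  bounds that of every variable with values in \<open>[0, 1]\<close> and mean \<open>\<mu>\<close>.\<close>

definition bcgf :: "real \<Rightarrow> real \<Rightarrow> real" where
  "bcgf t \<mu> = ln (1 + \<mu> * (exp t - 1))"

text \<open>The exponent \<open>t\<close> that minimizes \<open>bcgf t p - t * z\<close>.\<close>

definition tilt :: "real \<Rightarrow> real \<Rightarrow> real" where
  "tilt z p = ln (z * (1 - p) / (p * (1 - z)))"

lemma bcgf_arg_pos:
  fixes \<mu> t :: real
  assumes "0 \<le> \<mu>" "\<mu> \<le> 1"
  shows "1 + \<mu> * (exp t - 1) > 0"
proof (cases "\<mu> = 1")
  case False
  have "1 + \<mu> * (exp t - 1) = (1 - \<mu>) + \<mu> * exp t"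
    by (simp add: algebra_simps)
  also have "\<dots> > 0"
    using assms False add_nonneg_pos[of "\<mu> * exp t" "1 - \<mu>"] by (simp add: add.commute)
  finally show ?thesis .
qed simp

lemma bcgf_nonneg:
  assumes "0 \<le> \<mu>" "0 \<le> t"
  shows "bcgf t \<mu> \<ge> 0"
  using assms by (simp add: bcgf_def)

lemma bcgf_nonpos:
  assumes "0 \<le> \<mu>" "\<mu> \<le> 1" "t \<le> 0"
  shows "bcgf t \<mu> \<le> 0"
proof -
  have "\<mu> * (exp t - 1) \<le> 0"
    using assms by (simp add: mult_nonneg_nonpos)
  then show ?thesis
    using bcgf_arg_pos[OF assms(1,2), of t] by (simp add: bcgf_def)
qed

text \<open>For fixed \<open>t\<close>, \<open>bcgf t\<close> is concave in the mean and vanishes at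
  mean \<open>0\<close>, so its ratio to the mean does not increase.\<close>

lemma bcgf_chord:
  assumes "0 < p" "p \<le> \<mu>" "\<mu> \<le> 1"
  shows "p * bcgf t \<mu> \<le> \<mu> * bcgf t p"
proof -
  define y where "y = 1 + \<mu> * (exp t - 1)"
  have "y > 0" unfolding y_def using assms by (intro bcgf_arg_pos) auto
  then have "(1 - p / \<mu>) * ln 1 + p / \<mu> * ln y \<le> ln ((1 - p / \<mu>) *\<^sub>R 1 + (p / \<mu>) *\<^sub>R y)"
    using assms by (intro concave_onD[OF ln_concave]) auto
  also have "(1 - p / \<mu>) *\<^sub>R 1 + (p / \<mu>) *\<^sub>R y = 1 + p * (exp t - 1)"
    using assms by (simp add: y_def field_simps)
  finally show ?thesis
    using assms by (simp add: bcgf_def y_def field_simps)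
qed

text \<open>A concave function lies below its tangent; the last factor is the derivative of
  \<open>bcgf t\<close> at \<open>p\<close>.\<close>

lemma bcgf_tangent:
  assumes "0 \<le> p" "p \<le> 1" "0 \<le> \<mu>" "\<mu> \<le> 1"
  shows "bcgf t \<mu> \<le> bcgf t p + (\<mu> - p) * ((exp t - 1) / (1 + p * (exp t - 1)))"
proof -
  define x y where "x = 1 + p * (exp t - 1)" and "y = 1 + \<mu> * (exp t - 1)"
  have pos: "x > 0" "y > 0" unfolding x_def y_def using assms by (auto intro!: bcgf_arg_pos)
  have "ln y - ln x = ln (y / x)" using pos by (simp add: ln_div)
  also have "\<dots> \<le> y / x - 1" using pos by (intro ln_le_minus_one) auto
  also have "\<dots> = (y - x) / x" using pos by (simp add: field_simps)
  also have "y - x = (\<mu> - p) * (exp t - 1)" by (simp add: x_def y_def algebra_simps)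
  finally show ?thesis by (simp add: bcgf_def x_def y_def)
qed

text \<open>For \<open>p \<le> 1/2\<close> a Bernoulli variable is skewed to the right: after
  centring, its cumulant generating function at \<open>-t\<close> is at most that at
  \<open>t\<close>. This lets upper-tail exponents serve for the lower tail.\<close>

lemma bcgf_skew:
  assumes "0 \<le> p" "p \<le> 1/2" "0 \<le> t"
  shows "bcgf (-t) p + 2 * p * t \<le> bcgf t p"
proof -
  define F where "F s = bcgf s p - bcgf (-s) p - 2 * p * s" for s
  have "F 0 \<le> F t"
  proof (rule DERIV_nonneg_imp_nondecreasing[OF \<open>0 \<le> t\<close>])
    fix s :: real assume "0 \<le> s"
    define u where "u = exp s"
    have u: "u > 0" and inv: "exp (-s) = 1 / u" by (auto simp: u_def exp_minus field_simps)
    define a b where "a = 1 + p * (u - 1)" and "b = (1 - p) * u + p"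
    have a: "a > 0" using bcgf_arg_pos[of p s] assms by (simp add: a_def u_def)
    have b: "b > 0" using assms u by (auto simp: b_def intro!: add_pos_nonneg mult_pos_pos)
    have bu: "1 + p * (exp (-s) - 1) = b / u"
      using u unfolding inv by (simp add: b_def field_simps)
    have "(F has_real_derivative
        (p * exp s / (1 + p * (exp s - 1)) + p * exp (-s) / (1 + p * (exp (-s) - 1)) - 2 * p)) (at s)"
      unfolding F_def bcgf_def
      using assms bcgf_arg_pos[of p s] bcgf_arg_pos[of p "-s"]
      by (auto intro!: derivative_eq_intros simp: mult_ac)
    also have "p * exp s / (1 + p * (exp s - 1)) + p * exp (-s) / (1 + p * (exp (-s) - 1)) - 2 * p
        = p * (u / a + 1 / b - 2)"
      unfolding bu using u by (simp add: a_def inv flip: u_def) (simp add: algebra_simps)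
    \<comment> \<open>The derivative of \<open>F\<close> is a square times \<open>1 - 2 * p\<close>,
      up to nonnegative factors; its sign rests on \<open>p \<le> 1/2\<close>.\<close>
    also have "u / a + 1 / b - 2 = (1 - p) * (1 - 2 * p) * (u - 1)\<^sup>2 / (a * b)"
    proof -
      have "u * b + a - 2 * (a * b) = (1 - p) * (1 - 2 * p) * (u - 1)\<^sup>2"
        unfolding a_def b_def by algebra
      then show ?thesis using a b by (simp add: field_simps)
    qed
    finally have "(F has_real_derivative (p * ((1 - p) * (1 - 2 * p) * (u - 1)\<^sup>2 / (a * b)))) (at s)" .
    moreover have "0 \<le> p * ((1 - p) * (1 - 2 * p) * (u - 1)\<^sup>2 / (a * b))"
      using a b assms by (intro mult_nonneg_nonneg divide_nonneg_nonneg) auto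
    ultimately show "\<exists>y. (F has_real_derivative y) (at s) \<and> 0 \<le> y" by blast
  qed
  then show ?thesis by (simp add: F_def bcgf_def)
qed

text \<open>Closed forms at the optimal exponent; the third is the slope occurring in
  \<open>bcgf_tangent\<close>.\<close>

lemma exp_tilt:
  assumes "0 < z" "z < 1" "0 < p" "p < 1"
  shows "exp (tilt z p) - 1 = (z - p) / (p * (1 - z))"
    and "1 + p * (exp (tilt z p) - 1) = (1 - p) / (1 - z)"
    and "(exp (tilt z p) - 1) / (1 + p * (exp (tilt z p) - 1)) = (z - p) / (p * (1 - p))"
proof -
  have "exp (tilt z p) = z * (1 - p) / (p * (1 - z))"
    using assms by (simp add: tilt_def)
  then show *: "exp (tilt z p) - 1 = (z - p) / (p * (1 - z))"
    using assms by (simp add: field_simps)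
  show "1 + p * (exp (tilt z p) - 1) = (1 - p) / (1 - z)"
    unfolding * using assms by (simp add: field_simps)
  then show "(exp (tilt z p) - 1) / (1 + p * (exp (tilt z p) - 1)) = (z - p) / (p * (1 - p))"
    unfolding * using assms by simp
qed

text \<open>\<open>M_B z p\<close> is minus the Kullback-Leibler divergence of
  Bernoulli(\<open>z\<close>) from Bernoulli(\<open>p\<close>); this identifies it with the Chernoff
  exponent per sample at level \<open>z\<close>.\<close>

lemma M_B_eq_bcgf:
  assumes "0 < z" "z < 1" "0 < p" "p < 1"
  shows "M_B z p = bcgf (tilt z p) p - tilt z p * z"
proof -
  have "tilt z p = ln z + ln (1 - p) - (ln p + ln (1 - z))"
    using assms by (simp add: tilt_def ln_div ln_mult)
  then show ?thesis
    unfolding bcgf_def exp_tilt(2)[OF assms] M_B_def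
    using assms by (simp add: ln_div) (simp add: algebra_simps)
qed

text \<open>Gibbs' inequality: \<open>ln x \<le> x - 1\<close> in both terms, strict in the first
  because \<open>z \<noteq> p\<close>, and the two bounds cancel.\<close>

lemma M_B_neg:
  assumes "0 < z" "z < 1" "0 < p" "p < 1" "z \<noteq> p"
  shows "M_B z p < 0"
proof -
  have "ln (p / z) < p / z - 1"
    using assms ln_le_minus_one[of "p / z"] ln_eq_minus_one[of "p / z"] by fastforce
  moreover have "ln ((1 - p) / (1 - z)) \<le> (1 - p) / (1 - z) - 1"
    using assms by (intro ln_le_minus_one) auto
  ultimately have "M_B z p < z * (p / z - 1) + (1 - z) * ((1 - p) / (1 - z) - 1)"
    unfolding M_B_def using assms
    by (intro add_less_le_mono mult_strict_left_mono mult_left_mono) auto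
  also have "\<dots> = 0" using assms by (simp add: field_simps)
  finally show ?thesis .
qed

lemma tilt_pos:
  assumes "p < z" "z < 1" "0 < p"
  shows "tilt z p > 0"
  unfolding tilt_def using assms by (simp add: field_simps)

lemma tilt_neg:
  assumes "z < p" "0 < z" "p < 1"
  shows "tilt z p < 0"
  unfolding tilt_def using assms by (simp add: field_simps)

text \<open>\<open>tilt z p\<close> is a difference of logits. The logit is concave up to
  \<open>1/2\<close>, so it lies below its tangent at \<open>p\<close>. The bound equals the slope
  in \<open>exp_tilt(3)\<close>.\<close>

lemma tilt_le:
  assumes "0 < p" "p \<le> z" "z \<le> 1/2"
  shows "tilt z p \<le> (z - p) / (p * (1 - p))"
proof -
  define h where "h x = (x - p) / (p * (1 - p)) - (ln x - ln (1 - x))" for x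
  have "h p \<le> h z"
  proof (rule DERIV_nonneg_imp_nondecreasing[OF \<open>p \<le> z\<close>])
    fix x assume x: "p \<le> x" "x \<le> z"
    have "(h has_real_derivative 1 / (p * (1 - p)) - (1 / x + 1 / (1 - x))) (at x)"
      unfolding h_def using assms x
      by (auto intro!: derivative_eq_intros simp del: mult_eq_0_iff)
    moreover have "1 / x + 1 / (1 - x) = 1 / (x * (1 - x))"
      using assms x by (simp add: field_simps)
    moreover have "p * (1 - p) \<le> x * (1 - x)"
    proof -
      have "0 \<le> (x - p) * (1 - x - p)" using assms x by (intro mult_nonneg_nonneg) auto
      then show ?thesis by (simp add: algebra_simps)
    qed
    then have "1 / (x * (1 - x)) \<le> 1 / (p * (1 - p))"
      using assms x by (intro divide_left_mono) auto
    ultimately show "\<exists>y. (h has_real_derivative y) (at x) \<and> 0 \<le> y"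
      by (intro exI[of _ "1 / (p * (1 - p)) - (1 / x + 1 / (1 - x))"]) auto
  qed
  then show ?thesis
    using assms by (simp add: h_def tilt_def ln_div ln_mult)
qed

text \<open>The tangent at \<open>p\<close> has slope at least \<open>t\<close> by
  \<open>tilt_le\<close>. Moving \<open>\<mu>\<close> below \<open>p\<close> thus lowers
  \<open>bcgf\<close> by at least the amount by which \<open>- t * (\<mu> + \<epsilon>)\<close>
  rises.\<close>

lemma upper_exponent_additive:
  assumes "0 < \<mu>" "\<mu> \<le> p" "0 < \<epsilon>" "p + \<epsilon> \<le> 1/2"
  defines "t \<equiv> tilt (p + \<epsilon>) p"
  shows "bcgf t \<mu> - t * (\<mu> + \<epsilon>) \<le> M_B (p + \<epsilon>) p"
proof -
  have z: "0 < p + \<epsilon>" "p + \<epsilon> < 1" "0 < p" "p < 1" using assms by auto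
  have "(exp t - 1) / (1 + p * (exp t - 1)) = \<epsilon> / (p * (1 - p))"
    unfolding t_def exp_tilt(3)[OF z] by simp
  then have "bcgf t \<mu> \<le> bcgf t p + (\<mu> - p) * (\<epsilon> / (p * (1 - p)))"
    using bcgf_tangent[of p \<mu> t] assms by simp
  also have "\<dots> \<le> bcgf t p + (\<mu> - p) * t"
    using tilt_le[of p "p + \<epsilon>"] assms
    by (intro add_left_mono mult_left_mono_neg) auto
  finally show ?thesis
    unfolding M_B_eq_bcgf[OF z] by (simp add: t_def algebra_simps)
qed

text \<open>For a level proportional to \<open>\<mu>\<close>, the chord bound scales the whole
  exponent at \<open>p\<close> by \<open>\<mu> / p\<close>. It is used with \<open>r\<close> equal
  to \<open>1 + \<epsilon>\<^sub>r\<close> and \<open>1 - \<epsilon>\<^sub>r\<close>.\<close>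

lemma bcgf_chord_linear:
  assumes "0 < p" "p \<le> \<mu>" "\<mu> \<le> 1"
  shows "bcgf t \<mu> - t * (\<mu> * r) \<le> \<mu> / p * (bcgf t p - t * (p * r))"
  using bcgf_chord[OF assms, of t] assms by (simp add: field_simps)

text \<open>The first bound is per sample, for \<open>n\<close> samples against
  \<open>n * U\<close>; the second is per unit of threshold, for \<open>\<gamma> / U\<close> samples
  against \<open>\<gamma>\<close>.\<close>

lemma upper_exponent:
  fixes \<mu> p \<epsilon>\<^sub>a \<epsilon>\<^sub>r :: real
  assumes "0 < \<mu>" "\<mu> \<le> 1" "0 < \<epsilon>\<^sub>a" "0 < p" "p + \<epsilon>\<^sub>a \<le> 1/2" "\<epsilon>\<^sub>a = p * \<epsilon>\<^sub>r"
  defines "t \<equiv> tilt (p + \<epsilon>\<^sub>a) p" and "U \<equiv> \<mu> + max \<epsilon>\<^sub>a (\<mu> * \<epsilon>\<^sub>r)"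
  shows "bcgf t \<mu> - t * U \<le> M_B (p + \<epsilon>\<^sub>a) p"
    and "(bcgf t \<mu> - t * U) / U \<le> M_I (p + \<epsilon>\<^sub>a) p"
proof -
  have z: "0 < p + \<epsilon>\<^sub>a" "p + \<epsilon>\<^sub>a < 1" "0 < p" "p < 1" using assms by auto
  have neg: "M_B (p + \<epsilon>\<^sub>a) p < 0" using M_B_neg[OF z] \<open>0 < \<epsilon>\<^sub>a\<close> by simp
  have U: "U > 0" using assms by (auto simp: U_def)
  have "bcgf t \<mu> - t * U \<le> M_B (p + \<epsilon>\<^sub>a) p \<and> (bcgf t \<mu> - t * U) / U \<le> M_I (p + \<epsilon>\<^sub>a) p"
  \<comment> \<open>Since \<open>\<epsilon>\<^sub>a = p * \<epsilon>\<^sub>r\<close>, the maximum in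
    \<open>U\<close> switches from the absolute to the relative tolerance exactly at
    \<open>\<mu> = p\<close>.\<close>
  proof (cases "\<mu> \<le> p")
    case True
    have U_eq: "U = \<mu> + \<epsilon>\<^sub>a"
      using True assms by (simp add: U_def max_def zero_less_mult_iff)
    have le: "bcgf t \<mu> - t * U \<le> M_B (p + \<epsilon>\<^sub>a) p"
      unfolding U_eq t_def using assms True by (intro upper_exponent_additive) auto
    then have "(bcgf t \<mu> - t * U) / U \<le> M_B (p + \<epsilon>\<^sub>a) p / U"
      using U by (intro divide_right_mono) auto
    \<comment> \<open>The numerator is negative and
      \<open>U \<le> p + \<epsilon>\<^sub>a\<close>.\<close>
    also have "\<dots> \<le> M_B (p + \<epsilon>\<^sub>a) p / (p + \<epsilon>\<^sub>a)"
      using U neg True z by (intro divide_left_mono_neg) (auto simp: U_eq)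
    finally show ?thesis using le by (simp add: M_I_def)
  next
    case False
    have U_eq: "U = \<mu> * (1 + \<epsilon>\<^sub>r)"
      using False assms by (simp add: U_def max_def zero_less_mult_iff algebra_simps)
    have pe: "p * (1 + \<epsilon>\<^sub>r) = p + \<epsilon>\<^sub>a" using assms by (simp add: algebra_simps)
    have *: "bcgf t \<mu> - t * U \<le> \<mu> / p * M_B (p + \<epsilon>\<^sub>a) p"
      using bcgf_chord_linear[of p \<mu> t "1 + \<epsilon>\<^sub>r"] False assms
      unfolding U_eq M_B_eq_bcgf[OF z] pe t_def by simp
    also have "\<dots> \<le> 1 * M_B (p + \<epsilon>\<^sub>a) p"
      using neg False z by (intro mult_right_mono_neg) auto
    finally have 1: "bcgf t \<mu> - t * U \<le> M_B (p + \<epsilon>\<^sub>a) p" by simp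
    have "(bcgf t \<mu> - t * U) / U \<le> \<mu> / p * M_B (p + \<epsilon>\<^sub>a) p / U"
      using * U by (intro divide_right_mono) auto
    also have "\<dots> = M_B (p + \<epsilon>\<^sub>a) p / (p * (1 + \<epsilon>\<^sub>r))"
      unfolding U_eq using \<open>0 < \<mu>\<close> by simp
    finally show ?thesis using 1 by (simp add: pe M_I_def)
  qed
  then show "bcgf t \<mu> - t * U \<le> M_B (p + \<epsilon>\<^sub>a) p" "(bcgf t \<mu> - t * U) / U \<le> M_I (p + \<epsilon>\<^sub>a) p"
    by auto
qed

text \<open>The exponent is \<open>-t\<close> with the \<open>t\<close> of the upper tail. By
  \<open>bcgf_skew\<close> the bound reduces to the upper one, so a single condition on
  \<open>n\<close> covers both tails.\<close>

lemma lower_exponent_truncated: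
  fixes \<mu> p \<epsilon>\<^sub>a \<epsilon>\<^sub>r :: real
  assumes "0 < \<mu>" "\<mu> \<le> 1" "0 < \<epsilon>\<^sub>a" "0 < p" "p + \<epsilon>\<^sub>a \<le> 1/2" "\<epsilon>\<^sub>a = p * \<epsilon>\<^sub>r"
  defines "t \<equiv> tilt (p + \<epsilon>\<^sub>a) p" and "L \<equiv> \<mu> - max \<epsilon>\<^sub>a (\<mu> * \<epsilon>\<^sub>r)"
  shows "bcgf (-t) \<mu> + t * L \<le> M_B (p + \<epsilon>\<^sub>a) p"
proof -
  have z: "0 < p + \<epsilon>\<^sub>a" "p + \<epsilon>\<^sub>a < 1" "0 < p" "p < 1" using assms by auto
  have neg: "M_B (p + \<epsilon>\<^sub>a) p < 0" using M_B_neg[OF z] \<open>0 < \<epsilon>\<^sub>a\<close> by simp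
  have t: "t > 0" unfolding t_def using assms by (intro tilt_pos) auto
  show ?thesis
  proof (cases "\<mu> \<le> p")
    case True
    have "L = \<mu> - \<epsilon>\<^sub>a"
      using True assms by (simp add: L_def max_def zero_less_mult_iff)
    then have "bcgf (-t) \<mu> + t * L \<le> bcgf t \<mu> - t * (\<mu> + \<epsilon>\<^sub>a)"
      using bcgf_skew[of \<mu> t] assms True t by (simp add: algebra_simps)
    also have "\<dots> \<le> M_B (p + \<epsilon>\<^sub>a) p"
      unfolding t_def using assms True by (intro upper_exponent_additive) auto
    finally show ?thesis .
  next
    case False
    have L_eq: "L = \<mu> * (1 - \<epsilon>\<^sub>r)"
      using False assms by (simp add: L_def max_def zero_less_mult_iff algebra_simps)
    have pe: "p * (1 - \<epsilon>\<^sub>r) = p - \<epsilon>\<^sub>a" using assms by (simp add: algebra_simps)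
    \<comment> \<open>Skewness is used at \<open>p\<close>, because \<open>\<mu>\<close> may exceed
      \<open>1/2\<close> here; the chord then passes from \<open>p\<close> to
      \<open>\<mu>\<close>.\<close>
    have at_p: "bcgf (-t) p + t * (p - \<epsilon>\<^sub>a) \<le> M_B (p + \<epsilon>\<^sub>a) p"
      unfolding M_B_eq_bcgf[OF z]
      using bcgf_skew[of p t] assms t by (simp add: t_def algebra_simps)
    have "bcgf (-t) \<mu> + t * L \<le> \<mu> / p * (bcgf (-t) p + t * (p - \<epsilon>\<^sub>a))"
      using bcgf_chord_linear[of p \<mu> "-t" "1 - \<epsilon>\<^sub>r"] False assms
      unfolding L_eq pe by simp
    also have "\<dots> \<le> \<mu> / p * M_B (p + \<epsilon>\<^sub>a) p"
      using at_p assms by (intro mult_left_mono) auto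
    also have "\<dots> \<le> 1 * M_B (p + \<epsilon>\<^sub>a) p"
      using neg False z by (intro mult_right_mono_neg) auto
    finally show ?thesis by simp
  qed
qed

text \<open>For \<open>\<epsilon> < p\<close> the claim puts \<open>bcgf t\<close> below the line
  through \<open>(\<epsilon>, 0)\<close> and \<open>(p, bcgf t p)\<close>. Left of \<open>p\<close>
  the tangent at \<open>p\<close> lies below that line, as its slope \<open>- v\<close> is no
  smaller.\<close>

lemma lower_exponent_additive:
  assumes "\<epsilon> \<le> \<mu>" "\<mu> \<le> p" "0 < \<epsilon>" "p \<le> 1/2" "0 < z" "p - \<epsilon> \<le> z" "z < p"
  defines "t \<equiv> tilt z p"
  shows "(p - \<epsilon>) * bcgf t \<mu> \<le> (\<mu> - \<epsilon>) * bcgf t p"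
proof -
  have z: "0 < z" "z < 1" "0 < p" "p < 1" using assms by auto
  define v where "v = (p - z) / (p * (1 - p))"
  have v: "v > 0" using assms z by (simp add: v_def)
  have eq: "(exp t - 1) / (1 + p * (exp t - 1)) = - v"
    unfolding t_def exp_tilt(3)[OF z] v_def by (simp add: minus_divide_left)
  have tangent: "bcgf t \<mu> \<le> bcgf t p + (\<mu> - p) * (- v)"
    using bcgf_tangent[of p \<mu> t] assms z unfolding eq by simp
  have "bcgf t p = ln ((1 - p) / (1 - z))"
    unfolding bcgf_def t_def exp_tilt(2)[OF z] ..
  also have "\<dots> \<le> (1 - p) / (1 - z) - 1"
    using z by (intro ln_le_minus_one) auto
  also have "\<dots> = - ((p - z) / (1 - z))"
    using z by (simp add: divide_simps)
  finally have "bcgf t p \<le> - ((p - z) / (1 - z))" .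
  \<comment> \<open>This follows from \<open>p - \<epsilon> \<le> z\<close> and from
    \<open>z * (1 - z) \<le> p * (1 - p)\<close>, valid for \<open>z < p \<le> 1/2\<close>.\<close>
  moreover have "(p - \<epsilon>) * v \<le> (p - z) / (1 - z)"
  proof -
    have "(p - \<epsilon>) * (1 - z) \<le> z * (1 - z)" using assms z by (intro mult_right_mono) auto
    also have "\<dots> \<le> p * (1 - p)"
    proof -
      have "0 \<le> (p - z) * (1 - z - p)" using assms by (intro mult_nonneg_nonneg) auto
      then show ?thesis by (simp add: algebra_simps)
    qed
    finally have "(p - z) * ((p - \<epsilon>) * (1 - z)) \<le> (p - z) * (p * (1 - p))"
      using assms by (intro mult_left_mono) auto
    then show ?thesis using z by (simp add: v_def divide_simps mult_ac)
  qed
  ultimately have slope: "(p - \<epsilon>) * v \<le> - bcgf t p" by linarith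
  have "(p - \<epsilon>) * bcgf t \<mu> \<le> (p - \<epsilon>) * (bcgf t p + (\<mu> - p) * (- v))"
    using tangent assms by (intro mult_left_mono) auto
  also have "\<dots> = (p - \<epsilon>) * bcgf t p + (p - \<mu>) * ((p - \<epsilon>) * v)"
    by (simp add: algebra_simps)
  also have "\<dots> \<le> (p - \<epsilon>) * bcgf t p + (p - \<mu>) * (- bcgf t p)"
    using slope assms by (intro add_left_mono mult_left_mono) auto
  finally show ?thesis by (simp add: algebra_simps)
qed

text \<open>Rounding may cost one sample against \<open>\<gamma> / L\<close>. As
  \<open>L \<le> 1 - \<epsilon>\<^sub>r\<close>, still
  \<open>k \<ge> (\<gamma> - 1 + \<epsilon>\<^sub>r) / L\<close>; at \<open>\<mu> = p\<close>, a
  total of \<open>\<gamma>\<close> over that many samples has average \<open>z\<close>.\<close>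

lemma lower_exponent_inverse:
  fixes \<mu> p \<epsilon>\<^sub>a \<epsilon>\<^sub>r \<gamma> k :: real
  assumes "0 < \<mu>" "\<mu> \<le> 1" "0 < \<epsilon>\<^sub>a" "0 < p" "p \<le> 1/2" "\<epsilon>\<^sub>a = p * \<epsilon>\<^sub>r" "\<epsilon>\<^sub>r < 1"
    and \<gamma>: "\<gamma> > (1 - \<epsilon>\<^sub>r) / \<epsilon>\<^sub>r"
  defines "z \<equiv> \<gamma> * (p - \<epsilon>\<^sub>a) / (\<gamma> - 1 + \<epsilon>\<^sub>r)" and "L \<equiv> \<mu> - max \<epsilon>\<^sub>a (\<mu> * \<epsilon>\<^sub>r)"
  assumes "L > 0" and k: "\<gamma> / L - 1 \<le> k"
  shows "0 < z" "z < p" "k * bcgf (tilt z p) \<mu> - tilt z p * \<gamma> \<le> \<gamma> * M_I z p"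
proof -
  have r: "0 < \<epsilon>\<^sub>r" using assms by (simp add: zero_less_mult_iff)
  define w where "w = \<gamma> - 1 + \<epsilon>\<^sub>r"
  have "1 - \<epsilon>\<^sub>r \<le> (1 - \<epsilon>\<^sub>r) / \<epsilon>\<^sub>r" using r assms(7) by (simp add: pos_le_divide_eq mult_left_le)
  then have w: "w > 0" using \<gamma> by (simp add: w_def)
  have g: "\<gamma> > 0" using w assms(7) by (simp add: w_def)
  have pe: "p - \<epsilon>\<^sub>a = p * (1 - \<epsilon>\<^sub>r)" using assms by (simp add: algebra_simps)
  then have pe0: "p - \<epsilon>\<^sub>a > 0" using assms by simp
  have zw: "z = \<gamma> * (p - \<epsilon>\<^sub>a) / w" by (simp add: z_def w_def)
  show z0: "0 < z" using g pe0 w by (simp add: zw)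
  \<comment> \<open>The lower bound on \<open>\<gamma>\<close> is what places \<open>z\<close> below
    \<open>p\<close>.\<close>
  have "1 - \<epsilon>\<^sub>r < \<gamma> * \<epsilon>\<^sub>r" using \<gamma> r by (simp add: field_simps)
  then have "\<gamma> * (1 - \<epsilon>\<^sub>r) < w" by (simp add: w_def algebra_simps)
  then have "p * (\<gamma> * (1 - \<epsilon>\<^sub>r)) < p * w" using assms by simp
  then show zp: "z < p" using w by (simp add: zw pe field_simps)
  have "(p - \<epsilon>\<^sub>a) * w \<le> (p - \<epsilon>\<^sub>a) * \<gamma>" using pe0 assms by (simp add: w_def)
  then have pez: "p - \<epsilon>\<^sub>a \<le> z" using w by (simp add: zw field_simps)
  have z: "0 < z" "z < 1" "0 < p" "p < 1" using z0 zp assms by auto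
  define t where "t = tilt z p"
  have t: "t < 0" unfolding t_def using z zp by (intro tilt_neg)
  have L1: "L \<le> 1 - \<epsilon>\<^sub>r"
  proof -
    have "L \<le> \<mu> * (1 - \<epsilon>\<^sub>r)" by (simp add: L_def algebra_simps)
    also have "\<dots> \<le> 1 * (1 - \<epsilon>\<^sub>r)" using assms by (intro mult_right_mono) auto
    finally show ?thesis by simp
  qed
  have "w / L \<le> (\<gamma> - L) / L"
    using L1 \<open>L > 0\<close> by (intro divide_right_mono) (auto simp: w_def)
  also have "\<dots> \<le> k" using k \<open>L > 0\<close> by (simp add: diff_divide_distrib)
  finally have "w / L \<le> k" .
  \<comment> \<open>For \<open>t < 0\<close> the function \<open>bcgf\<close> is nonpositive, so
    replacing \<open>k\<close> by a smaller number weakens the bound.\<close>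
  then have "k * bcgf t \<mu> \<le> w / L * bcgf t \<mu>"
    using bcgf_nonpos[of \<mu> t] assms t by (intro mult_right_mono_neg) auto
  also have "\<dots> \<le> w / L * (L / (p - \<epsilon>\<^sub>a) * bcgf t p)"
  proof -
    have "(p - \<epsilon>\<^sub>a) * bcgf t \<mu> \<le> L * bcgf t p"
    proof (cases "\<mu> \<le> p")
      case True
      then have "L = \<mu> - \<epsilon>\<^sub>a" using assms(6) r by (simp add: L_def max_def)
      then show ?thesis
        using lower_exponent_additive[of \<epsilon>\<^sub>a \<mu> p z] True \<open>L > 0\<close> assms pez zp z by (simp add: t_def)
    next
      case False
      then have "L = \<mu> * (1 - \<epsilon>\<^sub>r)" using assms(6) r by (simp add: L_def max_def algebra_simps)
      moreover have "(1 - \<epsilon>\<^sub>r) * (p * bcgf t \<mu>) \<le> (1 - \<epsilon>\<^sub>r) * (\<mu> * bcgf t p)"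
        using False assms by (intro mult_left_mono bcgf_chord) auto
      ultimately show ?thesis by (simp add: pe mult_ac)
    qed
    then have "bcgf t \<mu> \<le> L / (p - \<epsilon>\<^sub>a) * bcgf t p" using pe0 by (simp add: field_simps)
    then show ?thesis using w \<open>L > 0\<close> by (intro mult_left_mono) auto
  qed
  also have "\<dots> = \<gamma> * (bcgf t p / z)"
    using w pe0 g \<open>L > 0\<close> by (simp add: zw field_simps)
  finally have "k * bcgf t \<mu> - t * \<gamma> \<le> \<gamma> * (bcgf t p / z) - t * \<gamma>" by simp
  also have "\<dots> = \<gamma> * M_I z p"
    unfolding M_I_def M_B_eq_bcgf[OF z] using z by (simp add: t_def field_simps)
  finally show "k * bcgf (tilt z p) \<mu> - tilt z p * \<gamma> \<le> \<gamma> * M_I z p" by (simp add: t_def)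
qed

subsection \<open>The stopping rule\<close>

text \<open>The disjunct \<open>l = n\<close> encodes the truncation and makes the predicate
  satisfiable, so the infimum in \<open>enat\<close> becomes a least natural number.\<close>

lemma sample_number_eq_Least:
  assumes "n > 0"
  shows "sample_number \<gamma> n x = (LEAST l. l = n \<or> (1 \<le> l \<and> \<gamma> \<le> (\<Sum>i=1..l. x i)))"
    (is "_ = Least ?P")
proof -
  define A where "A = {enat l |l. 1 \<le> l \<and> \<gamma> \<le> (\<Sum>i=1..l. x i)}"
  have "?P (Least ?P)" by (rule LeastI[of ?P n]) simp
  then have "min (enat n) (Inf A) \<le> enat (Least ?P)"
  proof
    assume "1 \<le> Least ?P \<and> \<gamma> \<le> (\<Sum>i=1..Least ?P. x i)"
    then have "enat (Least ?P) \<in> A" unfolding A_def by blast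
    then show ?thesis by (intro min.coboundedI2 Inf_lower)
  qed auto
  moreover have "enat (Least ?P) \<le> min (enat n) (Inf A)"
    unfolding A_def by (intro min.boundedI Inf_greatest) (auto intro!: Least_le)
  ultimately have "min (enat n) (Inf A) = enat (Least ?P)" by (rule antisym)
  then show ?thesis by (simp add: sample_number_def A_def)
qed

lemma sample_number_pos:
  assumes "n > 0"
  shows "sample_number \<gamma> n x > 0"
  using LeastI[of "\<lambda>l. l = n \<or> (1 \<le> l \<and> \<gamma> \<le> (\<Sum>i=1..l. x i))" n] assms
  unfolding sample_number_eq_Least[OF assms] by auto

lemma sample_number_le:
  assumes "n > 0"
  shows "sample_number \<gamma> n x \<le> n"
  unfolding sample_number_eq_Least[OF assms] by (rule Least_le) simp

lemma sample_number_reached: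
  assumes "n > 0" "sample_number \<gamma> n x \<noteq> n"
  shows "\<gamma> \<le> sample_total \<gamma> n x"
  using LeastI[of "\<lambda>l. l = n \<or> (1 \<le> l \<and> \<gamma> \<le> (\<Sum>i=1..l. x i))" n] assms(2)
  unfolding sample_total_def sample_number_eq_Least[OF assms(1)] by auto

text \<open>Minimality handles \<open>l \<ge> 1\<close>; for \<open>l = 0\<close> the sum is empty
  and \<open>\<gamma> > 0\<close> suffices.\<close>

lemma sum_before_sample_number:
  assumes "n > 0" "\<gamma> > 0" "l < sample_number \<gamma> n x"
  shows "(\<Sum>i=1..l. x i) < \<gamma>"
  using assms(2,3) not_less_Least[of l "\<lambda>l. l = n \<or> (1 \<le> l \<and> \<gamma> \<le> (\<Sum>i=1..l. x i))"]
  unfolding sample_number_eq_Least[OF assms(1)] by (cases "l = 0") auto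

lemma partial_sum_mono:
  fixes x :: "nat \<Rightarrow> real"
  assumes "\<And>i. i \<ge> 1 \<Longrightarrow> 0 \<le> x i" "k \<le> m"
  shows "(\<Sum>i=1..k. x i) \<le> (\<Sum>i=1..m. x i)"
  using assms by (intro sum_mono2) auto

text \<open>With \<open>N\<close> the sample number, \<open>N * U\<close> is at most both the total
  and \<open>\<gamma>\<close>. If \<open>\<gamma> < n * U\<close>, sampling stopped before
  \<open>n\<close>, so \<open>\<gamma>\<close> was reached by time
  \<open>N \<le> \<gamma> / U\<close>.\<close>

lemma estimator_ge_imp_sum_ge:
  assumes n: "n > 0" and "\<gamma> > 0" "U > 0" and nonneg: "\<And>i. i \<ge> 1 \<Longrightarrow> 0 \<le> x i"
    and ge: "U \<le> tis_estimator \<gamma> n x"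
  shows "real n * U \<le> \<gamma> \<Longrightarrow> real n * U \<le> (\<Sum>i=1..n. x i)"
    and "\<gamma> < real n * U \<Longrightarrow> \<gamma> \<le> (\<Sum>i=1..nat \<lfloor>\<gamma> / U\<rfloor>. x i)"
proof -
  define N where "N = sample_number \<gamma> n x"
  have N: "N > 0" "N \<le> n"
    unfolding N_def using n by (auto intro: sample_number_pos sample_number_le)
  have S: "sample_total \<gamma> n x = (\<Sum>i=1..N. x i)" by (simp add: sample_total_def N_def)
  have NU: "real N * U \<le> (\<Sum>i=1..N. x i)" "real N * U \<le> \<gamma>"
    using ge N unfolding tis_estimator_def S N_def[symmetric] by (auto simp: field_simps)
  show "real n * U \<le> (\<Sum>i=1..n. x i)" if "real n * U \<le> \<gamma>"
  proof (cases "N = n")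
    case False
    then have "\<gamma> \<le> (\<Sum>i=1..N. x i)"
      using sample_number_reached[OF n, of \<gamma> x, folded N_def] S by simp
    also have "\<dots> \<le> (\<Sum>i=1..n. x i)" using N by (intro partial_sum_mono nonneg)
    finally show ?thesis using that by simp
  qed (use NU in simp)
  show "\<gamma> \<le> (\<Sum>i=1..nat \<lfloor>\<gamma> / U\<rfloor>. x i)" if "\<gamma> < real n * U"
  proof -
    have "N \<noteq> n" using that NU by auto
    then have "\<gamma> \<le> (\<Sum>i=1..N. x i)"
      using sample_number_reached[OF n, of \<gamma> x, folded N_def] S by simp
    also have "N \<le> nat \<lfloor>\<gamma> / U\<rfloor>"
      using NU(2) \<open>U > 0\<close> by (simp add: le_nat_floor field_simps)
    then have "(\<Sum>i=1..N. x i) \<le> (\<Sum>i=1..nat \<lfloor>\<gamma> / U\<rfloor>. x i)"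
      by (intro partial_sum_mono nonneg)
    finally show ?thesis .
  qed
qed

text \<open>If \<open>\<gamma>\<close> is reached, then \<open>N \<ge> \<gamma> / L\<close>, so one
  step before the rounded-up time the sum is still below \<open>\<gamma>\<close>. If it is not
  reached, then \<open>N = n\<close> and every earlier partial sum is below \<open>\<gamma>\<close>
  too.\<close>

lemma estimator_le_imp_sum_le:
  assumes n: "n > 0" and g: "\<gamma> > 0" and nonneg: "\<And>i. i \<ge> 1 \<Longrightarrow> 0 \<le> x i"
    and le: "tis_estimator \<gamma> n x \<le> L"
  shows "real n * L < \<gamma> \<Longrightarrow> (\<Sum>i=1..n. x i) \<le> real n * L"
    and "\<gamma> \<le> real n * L \<Longrightarrow> (\<Sum>i=1..nat \<lceil>\<gamma> / L\<rceil> - 1. x i) < \<gamma>"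
proof -
  define N where "N = sample_number \<gamma> n x"
  have N: "N > 0" "N \<le> n"
    unfolding N_def using n by (auto intro: sample_number_pos sample_number_le)
  have S: "sample_total \<gamma> n x = (\<Sum>i=1..N. x i)" by (simp add: sample_total_def N_def)
  have NL: "min (\<Sum>i=1..N. x i) \<gamma> \<le> real N * L"
    using le N unfolding tis_estimator_def S N_def[symmetric] by (simp add: field_simps)
  have reached: "\<gamma> \<le> (\<Sum>i=1..N. x i)" if "N \<noteq> n"
    using that sample_number_reached[OF n, of \<gamma> x, folded N_def] S by simp
  show "(\<Sum>i=1..n. x i) \<le> real n * L" if lt: "real n * L < \<gamma>"
  proof -
    have "\<not> \<gamma> \<le> real N * L"
    proof
      assume *: "\<gamma> \<le> real N * L"
      \<comment> \<open>\<open>L\<close> may be nonpositive in general; here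
        \<open>\<gamma> > 0\<close> rules that out.\<close>
      then have "L > 0" using g N by (smt (verit) mult_nonneg_nonpos of_nat_0_le_iff)
      then have "real N * L \<le> real n * L" using N by simp
      then show False using * lt by simp
    qed
    then show ?thesis using NL reached by (cases "N = n") auto
  qed
  show "(\<Sum>i=1..nat \<lceil>\<gamma> / L\<rceil> - 1. x i) < \<gamma>" if ge: "\<gamma> \<le> real n * L"
  proof -
    have L: "L > 0" using g ge n by (smt (verit) mult_nonneg_nonpos of_nat_0_le_iff)
    show ?thesis
    proof (cases "\<gamma> \<le> (\<Sum>i=1..N. x i)")
      case True
      then have "\<gamma> \<le> real N * L" using NL by simp
      then have "nat \<lceil>\<gamma> / L\<rceil> \<le> N" using L by (simp add: nat_le_iff ceiling_le_iff field_simps)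
      then have "nat \<lceil>\<gamma> / L\<rceil> - 1 < N" using N(1) by linarith
      then show ?thesis unfolding N_def using n g by (intro sum_before_sample_number)
    next
      case False
      then have "N = n" using reached by blast
      have "nat \<lceil>\<gamma> / L\<rceil> \<le> n" using ge L by (simp add: nat_le_iff ceiling_le_iff field_simps)
      then have "nat \<lceil>\<gamma> / L\<rceil> - 1 \<le> n" by linarith
      then have "(\<Sum>i=1..nat \<lceil>\<gamma> / L\<rceil> - 1. x i) \<le> (\<Sum>i=1..n. x i)"
        by (intro partial_sum_mono nonneg)
      then show ?thesis using False \<open>N = n\<close> by simp
    qed
  qed
qed

text \<open>The sample number is measurable with countably many values, so it suffices to treat each
  fixed sample size \<open>l\<close>.\<close>

lemma tis_estimator_measurable:
  fixes Xs :: "nat \<Rightarrow> 'a \<Rightarrow> real"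
  assumes "n > 0" and rv: "\<And>i. i \<ge> 1 \<Longrightarrow> Xs i \<in> borel_measurable M"
  shows "(\<lambda>\<omega>. tis_estimator \<gamma> n (\<lambda>i. Xs i \<omega>)) \<in> borel_measurable M"
proof -
  have [measurable]: "(\<lambda>\<omega>. \<Sum>i=1..l. Xs i \<omega>) \<in> borel_measurable M" for l
    using rv by (intro borel_measurable_sum) auto
  have "(\<lambda>\<omega>. sample_number \<gamma> n (\<lambda>i. Xs i \<omega>)) \<in> measurable M (count_space UNIV)"
    unfolding sample_number_eq_Least[OF \<open>n > 0\<close>] by measurable
  then have "(\<lambda>\<omega>. (\<lambda>l \<omega>. min (\<Sum>i=1..l. Xs i \<omega>) \<gamma> / real l)
      (sample_number \<gamma> n (\<lambda>i. Xs i \<omega>)) \<omega>) \<in> borel_measurable M"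
    by (rule measurable_compose_countable[rotated]) measurable
  then show ?thesis by (simp add: tis_estimator_def sample_total_def)
qed

subsection \<open>Chernoff bounds for partial sums\<close>

context prob_space
begin

text \<open>On \<open>[0, 1]\<close> the function \<open>exp (t * x)\<close> lies below its chord,
  whose expectation depends on the mean alone.\<close>

lemma mgf_unit_interval_le:
  fixes X :: "'a \<Rightarrow> real"
  assumes [measurable]: "X \<in> borel_measurable M" and X: "AE \<omega> in M. X \<omega> \<in> {0..1}"
  shows "integrable M (\<lambda>\<omega>. exp (t * X \<omega>))"
    and "expectation (\<lambda>\<omega>. exp (t * X \<omega>)) \<le> 1 + expectation X * (exp t - 1)"
proof -
  have chord: "exp (t * x) \<le> 1 + x * (exp t - 1)" if "x \<in> {0..1}" for x
    using convex_onD[OF exp_convex, of x 0 t] that by (simp add: algebra_simps)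
  have intX: "integrable M X"
    using X by (intro integrable_const_bound[of _ 1]) auto
  show int: "integrable M (\<lambda>\<omega>. exp (t * X \<omega>))"
  proof (rule integrable_const_bound[of _ "exp \<bar>t\<bar>"])
    show "AE \<omega> in M. norm (exp (t * X \<omega>)) \<le> exp \<bar>t\<bar>"
      using X
    proof eventually_elim
      case (elim \<omega>)
      have "t * X \<omega> \<le> \<bar>t\<bar> * X \<omega>" using elim by (intro mult_right_mono) auto
      also have "\<dots> \<le> \<bar>t\<bar>" using elim by (intro mult_left_le) auto
      finally show ?case by simp
    qed
  qed measurable
  have "expectation (\<lambda>\<omega>. exp (t * X \<omega>)) \<le> expectation (\<lambda>\<omega>. 1 + X \<omega> * (exp t - 1))"
    using intX int eventually_mono[OF X chord] by (intro integral_mono_AE) auto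
  also have "\<dots> = 1 + expectation X * (exp t - 1)"
    using intX by (simp add: prob_space)
  finally show "expectation (\<lambda>\<omega>. exp (t * X \<omega>)) \<le> 1 + expectation X * (exp t - 1)" .
qed

lemma mgf_partial_sum_le:
  fixes Xs :: "nat \<Rightarrow> 'a \<Rightarrow> real"
  assumes indep: "indep_vars (\<lambda>_. borel) Xs {1..}"
    and Xs: "\<And>i. i \<ge> 1 \<Longrightarrow> AE \<omega> in M. Xs i \<omega> \<in> {0..1}"
    and mean: "\<And>i. i \<ge> 1 \<Longrightarrow> expectation (Xs i) = \<mu>"
    and \<mu>: "0 \<le> \<mu>" "\<mu> \<le> 1"
  shows "integrable M (\<lambda>\<omega>. exp (t * (\<Sum>i=1..m. Xs i \<omega>)))"
    and "expectation (\<lambda>\<omega>. exp (t * (\<Sum>i=1..m. Xs i \<omega>))) \<le> exp (real m * bcgf t \<mu>)"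
proof -
  have rv: "Xs i \<in> borel_measurable M" if "i \<ge> 1" for i
    using indep that unfolding indep_vars_def by auto
  note mgf = mgf_unit_interval_le[OF rv Xs, unfolded mean]
  have ind: "indep_vars (\<lambda>_. borel) (\<lambda>i \<omega>. exp (t * Xs i \<omega>)) {1..m}"
    by (rule indep_vars_compose2[OF indep_vars_subset[OF indep]]) auto
  have eq: "exp (t * (\<Sum>i=1..m. Xs i \<omega>)) = (\<Prod>i=1..m. exp (t * Xs i \<omega>))" for \<omega>
    by (simp add: sum_distrib_left exp_sum)
  show "integrable M (\<lambda>\<omega>. exp (t * (\<Sum>i=1..m. Xs i \<omega>)))"
    unfolding eq by (rule indep_vars_integrable[OF _ ind]) (auto intro!: mgf)
  have "expectation (\<lambda>\<omega>. exp (t * (\<Sum>i=1..m. Xs i \<omega>)))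
      = (\<Prod>i=1..m. expectation (\<lambda>\<omega>. exp (t * Xs i \<omega>)))"
    unfolding eq by (rule indep_vars_lebesgue_integral[OF _ ind]) (auto intro!: mgf)
  also have "\<dots> \<le> (\<Prod>i=1..m. 1 + \<mu> * (exp t - 1))"
  proof (rule prod_mono, intro conjI)
    fix i assume "i \<in> {1..m}"
    then have "1 \<le> i" by simp
    then show "expectation (\<lambda>\<omega>. exp (t * Xs i \<omega>)) \<le> 1 + \<mu> * (exp t - 1)"
      using mgf(2)[of i t] mean[of i] by simp
  qed (auto intro: integral_nonneg_AE)
  also have "\<dots> = exp (real m * bcgf t \<mu>)"
    using bcgf_arg_pos[OF \<mu>] by (simp add: bcgf_def exp_of_nat_mult)
  finally show "expectation (\<lambda>\<omega>. exp (t * (\<Sum>i=1..m. Xs i \<omega>))) \<le> exp (real m * bcgf t \<mu>)" .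
qed

lemma chernoff_partial_sum:
  fixes Xs :: "nat \<Rightarrow> 'a \<Rightarrow> real"
  assumes indep: "indep_vars (\<lambda>_. borel) Xs {1..}"
    and Xs: "\<And>i. i \<ge> 1 \<Longrightarrow> AE \<omega> in M. Xs i \<omega> \<in> {0..1}"
    and mean: "\<And>i. i \<ge> 1 \<Longrightarrow> expectation (Xs i) = \<mu>"
    and \<mu>: "0 \<le> \<mu>" "\<mu> \<le> 1"
  shows "t > 0 \<Longrightarrow> prob {\<omega> \<in> space M. a \<le> (\<Sum>i=1..m. Xs i \<omega>)} \<le> exp (real m * bcgf t \<mu> - t * a)"
    and "t < 0 \<Longrightarrow> prob {\<omega> \<in> space M. (\<Sum>i=1..m. Xs i \<omega>) \<le> a} \<le> exp (real m * bcgf t \<mu> - t * a)"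
proof -
  define S where "S \<omega> = (\<Sum>i=1..m. Xs i \<omega>)" for \<omega>
  have int: "integrable M (\<lambda>\<omega>. exp (t * S \<omega>))"
    and E: "expectation (\<lambda>\<omega>. exp (t * S \<omega>)) \<le> exp (real m * bcgf t \<mu>)"
    unfolding S_def using mgf_partial_sum_le[OF assms] by auto
  \<comment> \<open>The Chernoff inequalities used below speak of set integrals; the set is the
    whole space.\<close>
  have set_int: "set_integrable M (space M) (\<lambda>\<omega>. exp (t * S \<omega>))"
    unfolding set_integrable_def by (rule integrable_mult_indicator) (auto intro: int)
  have bound: "exp (- t * a) * (\<integral>\<omega>\<in>space M. exp (t * S \<omega>) \<partial>M) \<le> exp (real m * bcgf t \<mu> - t * a)"
    using mult_left_mono[OF E, of "exp (- t * a)"] int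
    by (simp add: set_integral_space exp_diff exp_minus field_simps)
  show "prob {\<omega> \<in> space M. a \<le> (\<Sum>i=1..m. Xs i \<omega>)} \<le> exp (real m * bcgf t \<mu> - t * a)" if "t > 0"
    using Chernoff_ineq_ge[OF that set_int, of a] bound unfolding S_def by simp
  show "prob {\<omega> \<in> space M. (\<Sum>i=1..m. Xs i \<omega>) \<le> a} \<le> exp (real m * bcgf t \<mu> - t * a)" if "t < 0"
    using Chernoff_ineq_le[of "-t" "space M" S a] that set_int bound unfolding S_def by simp
qed

end

subsection \<open>The coverage probability\<close>

text \<open>Converts each condition on \<open>n\<close> or \<open>\<gamma>\<close> into a tail
  bound; \<open>c\<close> is a negative value of \<open>M_B\<close> or \<open>M_I\<close>, so
  division by it reverses the inequality.\<close>

lemma exp_less_of_div_less: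
  fixes c d g x :: real
  assumes "c < 0" "d > 0" "ln d / c < g" "x \<le> g * c"
  shows "exp x < d"
proof -
  have "g * c < ln d" using assms by (simp add: neg_divide_less_eq)
  then show ?thesis using assms by (metis exp_ln exp_less_mono le_less_trans)
qed

theorem theorem13:
  fixes M :: "'a measure"
    and X :: "'a \<Rightarrow> real"
    and Xs :: "nat \<Rightarrow> 'a \<Rightarrow> real"
    and \<mu> \<delta> \<epsilon>\<^sub>a \<epsilon>\<^sub>r p \<gamma> :: real
    and n :: nat
  assumes "prob_space M"
    and "X \<in> borel_measurable M"
    and "\<forall>\<omega>\<in>space M. X \<omega> \<in> {0..1}"
    and "\<mu> = prob_space.expectation M X"
    and "\<mu> > 0"
    and "prob_space.indep_vars M (\<lambda>_. borel) Xs {1..}"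
    and "\<forall>i\<ge>1. distr M borel (Xs i) = distr M borel X"
    and "0 < \<delta>" and "\<delta> < 1"
    and "0 < \<epsilon>\<^sub>a" and "\<epsilon>\<^sub>a < \<epsilon>\<^sub>r" and "\<epsilon>\<^sub>r < 1"
    and "p = \<epsilon>\<^sub>a / \<epsilon>\<^sub>r"
    and "p + \<epsilon>\<^sub>a \<le> 1 / 2"
    and "\<gamma> > 0" and "n > 0"
    and "\<gamma> > (1 - \<epsilon>\<^sub>r) / \<epsilon>\<^sub>r"
    and "\<gamma> > ln (\<delta> / 2) / M_I (\<gamma> * (p - \<epsilon>\<^sub>a) / (\<gamma> - 1 + \<epsilon>\<^sub>r)) p"
    and "\<gamma> > ln (\<delta> / 2) / M_I (p + \<epsilon>\<^sub>a) p"
    and "real n > ln (\<delta> / 2) / M_B (p + \<epsilon>\<^sub>a) p"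
  shows "prob_space.prob M {\<omega> \<in> space M.
           \<bar>tis_estimator \<gamma> n (\<lambda>i. Xs i \<omega>) - \<mu>\<bar> < \<epsilon>\<^sub>a \<or>
           \<bar>(tis_estimator \<gamma> n (\<lambda>i. Xs i \<omega>) - \<mu>) / \<mu>\<bar> < \<epsilon>\<^sub>r} > 1 - \<delta>"
proof -

  \<comment> \<open>Range and mean of the samples\<close>
  interpret prob_space M by fact
  note [measurable] = assms(2)
  have rv: "Xs i \<in> borel_measurable M" if "i \<ge> 1" for i
    using assms(6) that unfolding indep_vars_def by auto
  have X: "AE \<omega> in M. X \<omega> \<in> {0..1}" using assms(3) by (auto intro!: AE_I2)
  have Xs: "AE \<omega> in M. Xs i \<omega> \<in> {0..1}" if "i \<ge> 1" for i
  proof -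
    have "AE x in distr M borel X. x \<in> {0..1}" using X by (simp add: AE_distr_iff)
    also have "distr M borel X = distr M borel (Xs i)" using assms(7) that by simp
    finally show ?thesis using rv[OF that] by (simp add: AE_distr_iff)
  qed
  have mean: "expectation (Xs i) = \<mu>" if "i \<ge> 1" for i
  proof -
    have "expectation (Xs i) = (\<integral>x. x \<partial>distr M borel (Xs i))"
      using rv[OF that] by (simp add: integral_distr)
    also have "\<dots> = (\<integral>x. x \<partial>distr M borel X)" using assms(7) that by simp
    also have "\<dots> = \<mu>" by (simp add: integral_distr assms(4))
    finally show ?thesis .
  qed
  have "\<mu> \<le> expectation (\<lambda>_. 1)"
    unfolding assms(4) using X by (intro integral_mono_AE integrable_const_bound[of _ 1]) auto
  then have \<mu>: "0 \<le> \<mu>" "\<mu> \<le> 1" using \<open>\<mu> > 0\<close> by (auto simp: prob_space)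
  note chernoff = chernoff_partial_sum[OF assms(6) Xs mean \<mu>]

  have p0: "0 < p" using assms by simp
  have \<epsilon>a: "\<epsilon>\<^sub>a = p * \<epsilon>\<^sub>r" using assms by simp
  have p_half: "p \<le> 1/2" using assms by linarith
  have z: "0 < p + \<epsilon>\<^sub>a" "p + \<epsilon>\<^sub>a < 1" "0 < p" "p < 1" "p + \<epsilon>\<^sub>a \<noteq> p"
    using assms(10,14) p0 by auto
  define t where "t = tilt (p + \<epsilon>\<^sub>a) p"
  have t: "t > 0" unfolding t_def using z assms(10) by (intro tilt_pos) auto
  have MB: "M_B (p + \<epsilon>\<^sub>a) p < 0" using z by (intro M_B_neg)
  then have MI: "M_I (p + \<epsilon>\<^sub>a) p < 0" using z by (simp add: M_I_def divide_neg_pos)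
  define U L where "U = \<mu> + max \<epsilon>\<^sub>a (\<mu> * \<epsilon>\<^sub>r)" and "L = \<mu> - max \<epsilon>\<^sub>a (\<mu> * \<epsilon>\<^sub>r)"
  have U: "U > 0" using assms(5,10) by (auto simp: U_def)
  define est where "est \<omega> = tis_estimator \<gamma> n (\<lambda>i. Xs i \<omega>)" for \<omega>
  have [measurable]: "est \<in> borel_measurable M"
    unfolding est_def using rv assms(16) by (intro tis_estimator_measurable)
  have sum_measurable [measurable]: "(\<lambda>\<omega>. \<Sum>i=1..l. Xs i \<omega>) \<in> borel_measurable M" for l
    using rv by (intro borel_measurable_sum) auto
  have events: "{\<omega> \<in> space M. a \<le> (\<Sum>i=1..l. Xs i \<omega>)} \<in> events"
      "{\<omega> \<in> space M. (\<Sum>i=1..l. Xs i \<omega>) \<le> a} \<in> events" for a l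
    by measurable
  \<comment> \<open>Equality in distribution bounds the samples only almost surely, so the event
    inclusions are transferred outside a null set.\<close>
  have nonneg: "AE \<omega> in M. \<forall>i\<ge>1. 0 \<le> Xs i \<omega>"
    unfolding AE_all_countable using Xs by auto
  have mono: "prob {\<omega> \<in> space M. P \<omega>} \<le> prob {\<omega> \<in> space M. Q \<omega>}"
    if "\<And>\<omega>. (\<And>i. i \<ge> 1 \<Longrightarrow> 0 \<le> Xs i \<omega>) \<Longrightarrow> P \<omega> \<Longrightarrow> Q \<omega>" "{\<omega> \<in> space M. Q \<omega>} \<in> events" for P Q
    using nonneg that by (intro finite_measure_mono_AE) (auto elim!: eventually_mono)
  have d2: "\<delta> / 2 > 0" using assms(8) by simp
  note upper = upper_exponent[OF assms(5) \<mu>(2) assms(10) p0 assms(14) \<epsilon>a, folded t_def U_def]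

  \<comment> \<open>Upper tail\<close>
  have "prob {\<omega> \<in> space M. U \<le> est \<omega>} < \<delta> / 2"
  proof (cases "real n * U \<le> \<gamma>")
    case True
    have "prob {\<omega> \<in> space M. U \<le> est \<omega>} \<le> prob {\<omega> \<in> space M. real n * U \<le> (\<Sum>i=1..n. Xs i \<omega>)}"
      by (rule mono, unfold est_def, rule estimator_ge_imp_sum_ge(1)[OF assms(16,15) U])
         (use True events in auto)
    also have "\<dots> \<le> exp (real n * bcgf t \<mu> - t * (real n * U))"
      using t by (intro chernoff)
    also have "\<dots> < \<delta> / 2"
      using mult_left_mono[OF upper(1), of "real n"]
      by (intro exp_less_of_div_less[OF MB d2 assms(20)]) (simp add: algebra_simps)
    finally show ?thesis .
  next
    case False
    define m where "m = nat \<lfloor>\<gamma> / U\<rfloor>"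
    have m: "real m \<le> \<gamma> / U" unfolding m_def using U assms(15) by (intro of_nat_floor) auto
    have "prob {\<omega> \<in> space M. U \<le> est \<omega>} \<le> prob {\<omega> \<in> space M. \<gamma> \<le> (\<Sum>i=1..m. Xs i \<omega>)}"
      unfolding m_def
      by (rule mono, unfold est_def, rule estimator_ge_imp_sum_ge(2)[OF assms(16,15) U])
         (use False events in auto)
    also have "\<dots> \<le> exp (real m * bcgf t \<mu> - t * \<gamma>)"
      using t by (intro chernoff)
    also have "\<dots> < \<delta> / 2"
    proof (rule exp_less_of_div_less[OF MI d2 assms(19)])
      \<comment> \<open>Rounding down costs nothing here, since \<open>bcgf t \<mu> \<ge> 0\<close>
        for \<open>t > 0\<close>.\<close>
      have "real m * bcgf t \<mu> - t * \<gamma> \<le> \<gamma> / U * bcgf t \<mu> - t * \<gamma>"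
        using mult_right_mono[OF m bcgf_nonneg[of \<mu> t]] \<mu> t by simp
      also have "\<dots> = \<gamma> * ((bcgf t \<mu> - t * U) / U)"
        using U by (simp add: field_simps)
      also have "\<dots> \<le> \<gamma> * M_I (p + \<epsilon>\<^sub>a) p"
        using upper(2) assms(15) by (intro mult_left_mono) auto
      finally show "real m * bcgf t \<mu> - t * \<gamma> \<le> \<gamma> * M_I (p + \<epsilon>\<^sub>a) p" .
    qed
    finally show ?thesis .
  qed

  \<comment> \<open>Lower tail\<close>
  moreover have "prob {\<omega> \<in> space M. est \<omega> \<le> L} < \<delta> / 2"
  proof (cases "real n * L < \<gamma>")
    case True
    have "prob {\<omega> \<in> space M. est \<omega> \<le> L} \<le> prob {\<omega> \<in> space M. (\<Sum>i=1..n. Xs i \<omega>) \<le> real n * L}"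
      by (rule mono, unfold est_def, rule estimator_le_imp_sum_le(1)[OF assms(16,15)])
         (use True events in auto)
    also have "\<dots> \<le> exp (real n * bcgf (-t) \<mu> - (-t) * (real n * L))"
      using t by (intro chernoff) auto
    also have "\<dots> < \<delta> / 2"
      using mult_left_mono[OF lower_exponent_truncated[OF assms(5) \<mu>(2) assms(10) p0 assms(14) \<epsilon>a,
        folded t_def L_def], of "real n"]
      by (intro exp_less_of_div_less[OF MB d2 assms(20)]) (simp add: algebra_simps)
    finally show ?thesis .
  next
    case False
    then have "real n * L > 0" using assms(15) by linarith
    then have L: "L > 0" using assms(16) by (simp add: zero_less_mult_iff)
    define k where "k = nat \<lceil>\<gamma> / L\<rceil> - 1"
    have "\<gamma> / L > 0" using L assms(15) by simp
    then have k: "\<gamma> / L - 1 \<le> real k"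
      unfolding k_def by linarith
    define y where "y = \<gamma> * (p - \<epsilon>\<^sub>a) / (\<gamma> - 1 + \<epsilon>\<^sub>r)"
    note lower = lower_exponent_inverse[OF assms(5) \<mu>(2) assms(10) p0 p_half \<epsilon>a assms(12,17)
        L[unfolded L_def] k[unfolded L_def], folded L_def y_def]
    have y: "0 < y" "y < 1" "y \<noteq> p" using lower(1,2) z by auto
    then have MIy: "M_I y p < 0" using M_B_neg[of y p] z by (simp add: M_I_def divide_neg_pos)
    \<comment> \<open>The strict bound on the partial sum is weakened to fit the Chernoff
      inequality.\<close>
    have "prob {\<omega> \<in> space M. est \<omega> \<le> L} \<le> prob {\<omega> \<in> space M. (\<Sum>i=1..k. Xs i \<omega>) \<le> \<gamma>}"
      unfolding k_def
      by (rule mono, unfold est_def, rule less_imp_le[OF estimator_le_imp_sum_le(2)[OF assms(16,15)]])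
         (use False events in auto)
    also have "\<dots> \<le> exp (real k * bcgf (tilt y p) \<mu> - tilt y p * \<gamma>)"
      using tilt_neg[OF lower(2,1)] z by (intro chernoff) auto
    also have "\<dots> < \<delta> / 2"
      using lower(3) by (intro exp_less_of_div_less[OF MIy d2 assms(18)[folded y_def]])
    finally show ?thesis .
  qed

  \<comment> \<open>Union bound and complement\<close>
  ultimately have "prob {\<omega> \<in> space M. U \<le> est \<omega>} + prob {\<omega> \<in> space M. est \<omega> \<le> L} < \<delta>"
    by linarith
  moreover have "prob ({\<omega> \<in> space M. U \<le> est \<omega>} \<union> {\<omega> \<in> space M. est \<omega> \<le> L})
      \<le> prob {\<omega> \<in> space M. U \<le> est \<omega>} + prob {\<omega> \<in> space M. est \<omega> \<le> L}"
    by (intro measure_Un_le) measurable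
  moreover have "1 - prob ({\<omega> \<in> space M. U \<le> est \<omega>} \<union> {\<omega> \<in> space M. est \<omega> \<le> L})
      = prob (space M - ({\<omega> \<in> space M. U \<le> est \<omega>} \<union> {\<omega> \<in> space M. est \<omega> \<le> L}))"
    by (intro prob_compl[symmetric]) measurable
  moreover have "\<dots> \<le> prob {\<omega> \<in> space M. \<bar>est \<omega> - \<mu>\<bar> < \<epsilon>\<^sub>a \<or> \<bar>(est \<omega> - \<mu>) / \<mu>\<bar> < \<epsilon>\<^sub>r}"
  proof (intro finite_measure_mono)
    \<comment> \<open>Strictly between \<open>L\<close> and \<open>U\<close> the error is below the
      larger of the two tolerances, hence below one of them.\<close>
    have "\<bar>e - \<mu>\<bar> < \<epsilon>\<^sub>a \<or> \<bar>(e - \<mu>) / \<mu>\<bar> < \<epsilon>\<^sub>r" if "e < U" "L < e" for e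
      using that \<open>\<mu> > 0\<close> by (auto simp: U_def L_def abs_divide pos_divide_less_eq mult.commute)
    then show "space M - ({\<omega> \<in> space M. U \<le> est \<omega>} \<union> {\<omega> \<in> space M. est \<omega> \<le> L})
        \<subseteq> {\<omega> \<in> space M. \<bar>est \<omega> - \<mu>\<bar> < \<epsilon>\<^sub>a \<or> \<bar>(est \<omega> - \<mu>) / \<mu>\<bar> < \<epsilon>\<^sub>r}"
      using not_le by blast
  qed measurable
  ultimately show ?thesis unfolding est_def by linarith
qed

end
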